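(* Let $H$ be a finite group with identity $e$ and let $S\subseteq H$ be a generating set with $e\notin S$ and $S=S^{-1}$. Let $G=\operatorname{Cay}(H,S)$. If $hSh^{-1}=S$ for every $h\in S$, then $G$ is CDDR.
   Context: The Cayley graph $\operatorname{Cay}(H,S)$ has vertex set $H$, with $x,y$ adjacent iff $yx^{-1}\in S$. $\Gamma_i(u)$ is the set of vertices at distance exactly $i$ from $u$. A graph $G$ is CDDR (commutative distance degree-regular) if $|\Gamma_i(u)\cap\Gamma_j(v)|=|\Gamma_i(v)\cap\Gamma_j(u)|$ for all vertices $u,v$ and all $1\le i,j\le\operatorname{diam}(G)$. *)

theory Defs
  imports
    "Graph_Theory.Graph_Theory"
    "HOL-Algebra.Generated_Groups"
begin

(* Graphs are symmetric loop-free digraphs (locale graph), so an edge {x, y} is a pair of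
   opposite arcs. *)

definition Cay :: "('a, 'm) monoid_scheme \<Rightarrow> 'a set \<Rightarrow> 'a pair_pre_digraph" where
  "Cay H S = \<lparr> pverts = carrier H,
     parcs = {(x, y). x \<in> carrier H \<and> y \<in> carrier H \<and> y \<otimes>\<^bsub>H\<^esub> inv\<^bsub>H\<^esub> x \<in> S} \<rparr>"

(* Graph distance: the minimum cost of a walk when every arc has cost 1.
   The value is \<infinity> if there is no walk. *)
definition gdist :: "('v, 'e) pre_digraph \<Rightarrow> 'v \<Rightarrow> 'v \<Rightarrow> ereal" where
  "gdist G u v = wf_digraph.\<mu> G (\<lambda>_. 1) u v"

definition sphere_at :: "('v, 'e) pre_digraph \<Rightarrow> nat \<Rightarrow> 'v \<Rightarrow> 'v set" where
  "sphere_at G i u = {w \<in> verts G. gdist G u w = ereal (real i)}"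

definition diam :: "('v, 'e) pre_digraph \<Rightarrow> ereal" where
  "diam G = (SUP u\<in>verts G. SUP v\<in>verts G. gdist G u v)"

definition CDDR :: "('v, 'e) pre_digraph \<Rightarrow> bool" where
  "CDDR G \<longleftrightarrow>
    (\<forall>u\<in>verts G. \<forall>v\<in>verts G. \<forall>i j :: nat.
      1 \<le> i \<and> ereal (real i) \<le> diam G \<and> 1 \<le> j \<and> ereal (real j) \<le> diam G \<longrightarrow>
      card (sphere_at G i u \<inter> sphere_at G j v) = card (sphere_at G i v \<inter> sphere_at G j u))"

lemma (in wf_digraph) gdist_eq_INF_length:
  "gdist G u v = (INF p\<in>{p. awalk u p v}. ereal (real (length p)))"
proof -
  have "awalk_cost (\<lambda>_. 1) p = real (length p)" for p :: "'b list"
    by (induction p) auto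
  then show ?thesis
    unfolding gdist_def \<mu>_def by simp
qed

lemma (in group) Cay_graph:
  assumes "finite (carrier G)" "\<one> \<notin> S" "set_inv S = S"
  shows "graph (with_proj (Cay G S))"
proof -
  let ?C = "Cay G S"
  have fin: "finite (parcs ?C)"
    by (rule finite_subset[of _ "carrier G \<times> carrier G"]) (auto simp: Cay_def assms(1))
  have loop: "fst e \<noteq> snd e" if "e \<in> parcs ?C" for e
    using that assms(2) by (auto simp: Cay_def)
  have symm: "(y, x) \<in> parcs ?C" if "(x, y) \<in> parcs ?C" for x y
  proof -
    from that have xy: "x \<in> carrier G" "y \<in> carrier G" "y \<otimes> inv x \<in> S"
      by (auto simp: Cay_def)
    have "inv (y \<otimes> inv x) \<in> set_inv S"
      using xy(3) by (auto simp: SET_INV_def)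
    then have "x \<otimes> inv y \<in> S"
      using xy assms(3) by (simp add: inv_mult_group)
    with xy show ?thesis by (auto simp: Cay_def)
  qed
  have "pair_graph ?C"
  proof unfold_locales
    show "symmetric (with_proj ?C)"
      using symm by (auto simp: symmetric_def arcs_ends_def arc_to_ends_def sym_def)
  qed (auto simp: fin loop assms(1), auto simp: Cay_def assms(1))
  then show ?thesis by (rule pair_graph.pair_graphD_graph)
qed

end

theory Submission
  imports Defs
begin

text \<open>
  The hypothesis makes any two vertices \<open>u\<close>, \<open>v\<close> of the Cayley graph interchangeable by an
  automorphism, and a graph with this property is CDDR, because an isometric bijection that
  exchanges \<open>u\<close> and \<open>v\<close> carries \<open>\<Gamma>\<^sub>i(u) \<inter> \<Gamma>\<^sub>j(v)\<close> onto \<open>\<Gamma>\<^sub>i(v) \<inter> \<Gamma>\<^sub>j(u)\<close>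
  (lemma \<open>CDDR_if_isometries_exchange\<close>).

  The exchanging map is \<open>w \<mapsto> u w\<^sup>-\<^sup>1 v\<close>. It sends \<open>u\<close> to \<open>v\<close> and \<open>v\<close> to \<open>u\<close>, and it is inverted by
  the map of the same form with \<open>u\<close> and \<open>v\<close> interchanged. It turns the quotient \<open>y x\<^sup>-\<^sup>1\<close> of an
  arc into a conjugate of \<open>(y x\<^sup>-\<^sup>1)\<^sup>-\<^sup>1\<close>, so it preserves arcs as soon as \<open>S\<close> is closed under
  inverses and under conjugation by the whole group. The latter follows from closure under
  conjugation by \<open>S\<close> itself, since \<open>S\<close> generates the group (lemma
  \<open>conjugation_closed_if_generating\<close>).
\<close>

lemma CDDR_if_isometries_exchange:
  assumes exchange: "\<And>u v. u \<in> verts G \<Longrightarrow> v \<in> verts G \<Longrightarrow>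
    \<exists>f. bij_betw f (verts G) (verts G) \<and>
      (\<forall>x\<in>verts G. \<forall>y\<in>verts G. gdist G (f x) (f y) = gdist G x y) \<and> f u = v \<and> f v = u"
  shows "CDDR G"
  unfolding CDDR_def
proof (intro ballI allI impI)
  fix u v i j
  assume u: "u \<in> verts G" and v: "v \<in> verts G"
  obtain f where bij: "bij_betw f (verts G) (verts G)"
    and iso: "\<And>x y. x \<in> verts G \<Longrightarrow> y \<in> verts G \<Longrightarrow> gdist G (f x) (f y) = gdist G x y"
    and f: "f u = v" "f v = u"
    using exchange[OF u v] by blast
  have du: "gdist G v (f w) = gdist G u w" and dv: "gdist G u (f w) = gdist G v w"
    if "w \<in> verts G" for w
    using iso[OF u that] iso[OF v that] f by simp_all
  have "f ` (sphere_at G i u \<inter> sphere_at G j v) = sphere_at G i v \<inter> sphere_at G j u"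
  proof
    show "f ` (sphere_at G i u \<inter> sphere_at G j v) \<subseteq> sphere_at G i v \<inter> sphere_at G j u"
      using bij_betwE[OF bij] by (auto simp: sphere_at_def du dv)
    show "sphere_at G i v \<inter> sphere_at G j u \<subseteq> f ` (sphere_at G i u \<inter> sphere_at G j v)"
    proof
      fix z assume z: "z \<in> sphere_at G i v \<inter> sphere_at G j u"
      then have "z \<in> f ` verts G"
        using bij by (simp add: sphere_at_def bij_betw_def)
      then obtain w where "w \<in> verts G" "z = f w" by blast
      with z show "z \<in> f ` (sphere_at G i u \<inter> sphere_at G j v)"
        by (auto simp: sphere_at_def du dv)
    qed
  qed
  moreover have "inj_on f (sphere_at G i u \<inter> sphere_at G j v)"
    using bij by (rule inj_on_subset[OF bij_betw_imp_inj_on]) (auto simp: sphere_at_def)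
  ultimately show
    "card (sphere_at G i u \<inter> sphere_at G j v) = card (sphere_at G i v \<inter> sphere_at G j u)"
    by (metis card_image)
qed

text \<open>Endomorphisms do not increase distances, because the image of a walk is a walk of the
  same length.\<close>

lemma (in wf_digraph) gdist_endomorphism_le:
  assumes verts: "\<And>x. x \<in> verts G \<Longrightarrow> f x \<in> verts G"
    and arcs: "\<And>a. a \<in> arcs G \<Longrightarrow> g a \<in> arcs G"
    and ends: "\<And>a. a \<in> arcs G \<Longrightarrow> tail G (g a) = f (tail G a)"
      "\<And>a. a \<in> arcs G \<Longrightarrow> head G (g a) = f (head G a)"
  shows "gdist G (f u) (f v) \<le> gdist G u v"
proof -
  have walk: "awalk (f u) (map g p) (f v)" if "awalk u p v" for p
    using that by (induction p arbitrary: u) (auto simp: awalk_simps verts arcs ends)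
  show ?thesis
    unfolding gdist_eq_INF_length
    by (rule INF_mono) (metis walk length_map mem_Collect_eq order_refl)
qed

text \<open>The elements that conjugate \<open>S\<close> into itself are closed under products, and those in \<open>S\<close>
  come with their inverses because \<open>S\<close> is symmetric; hence the subgroup generated by \<open>S\<close>
  consists of such elements.\<close>

lemma (in group) conjugation_closed_if_generating:
  assumes sub: "S \<subseteq> carrier G" and gen: "generate G S = carrier G"
    and inv_closed: "\<And>s. s \<in> S \<Longrightarrow> inv s \<in> S"
    and conj: "\<And>h s. h \<in> S \<Longrightarrow> s \<in> S \<Longrightarrow> h \<otimes> s \<otimes> inv h \<in> S"
    and "g \<in> carrier G" "s \<in> S"
  shows "g \<otimes> s \<otimes> inv g \<in> S"
proof -
  have "g \<in> generate G S" using assms by simp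
  then show ?thesis using \<open>s \<in> S\<close>
  proof (induction arbitrary: s)
    case one
    then show ?case using sub by auto
  next
    case (incl h)
    then show ?case by (rule conj)
  next
    case (inv h)
    then show ?case by (intro conj inv_closed)
  next
    case (eng h1 h2)
    have "h1 \<in> carrier G" "h2 \<in> carrier G" "s \<in> carrier G"
      using eng sub gen by auto
    then have "h1 \<otimes> h2 \<otimes> s \<otimes> inv (h1 \<otimes> h2) = h1 \<otimes> (h2 \<otimes> s \<otimes> inv h2) \<otimes> inv h1"
      by (simp add: inv_mult_group m_assoc)
    with eng show ?case by simp
  qed
qed

lemma wf_digraph_Cay: "wf_digraph (with_proj (Cay H S))"
  by unfold_locales (auto simp: Cay_def)

definition (in monoid) exchange :: "'a \<Rightarrow> 'a \<Rightarrow> 'a \<Rightarrow> 'a" where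
  "exchange u v w = u \<otimes> inv w \<otimes> v"

context group
begin

lemma mult_inv_cancel:
  assumes "a \<in> carrier G" "b \<in> carrier G"
  shows "a \<otimes> (inv a \<otimes> b) = b" "inv a \<otimes> (a \<otimes> b) = b"
  using assms by (simp_all flip: m_assoc)

lemma exchange_closed [simp]:
  "u \<in> carrier G \<Longrightarrow> v \<in> carrier G \<Longrightarrow> w \<in> carrier G \<Longrightarrow> exchange u v w \<in> carrier G"
  by (simp add: exchange_def)

lemma exchange_left:
  "u \<in> carrier G \<Longrightarrow> v \<in> carrier G \<Longrightarrow> exchange u v u = v"
  by (simp add: exchange_def)

lemma exchange_right:
  "u \<in> carrier G \<Longrightarrow> v \<in> carrier G \<Longrightarrow> exchange u v v = u"
  by (simp add: exchange_def m_assoc)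

lemma exchange_exchange:
  assumes "u \<in> carrier G" "v \<in> carrier G" "w \<in> carrier G"
  shows "exchange u v (exchange v u w) = w"
  using assms by (simp add: exchange_def inv_mult_group m_assoc mult_inv_cancel)

text \<open>Inversion alone would send the quotient \<open>y x\<^sup>-\<^sup>1\<close> to \<open>y\<^sup>-\<^sup>1 x\<close>, which is conjugate under \<open>y\<close>
  to \<open>x y\<^sup>-\<^sup>1 = (y x\<^sup>-\<^sup>1)\<^sup>-\<^sup>1\<close>; the translations contribute a further conjugation by \<open>u\<close>.\<close>

lemma exchange_quotient:
  assumes "u \<in> carrier G" "v \<in> carrier G" "x \<in> carrier G" "y \<in> carrier G"
  shows "exchange u v y \<otimes> inv (exchange u v x)
    = (u \<otimes> inv y) \<otimes> inv (y \<otimes> inv x) \<otimes> inv (u \<otimes> inv y)"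
  using assms by (simp add: exchange_def inv_mult_group m_assoc mult_inv_cancel)

lemma gdist_Cay_exchange_le:
  assumes inv_closed: "\<And>s. s \<in> S \<Longrightarrow> inv s \<in> S"
    and conj: "\<And>g s. g \<in> carrier G \<Longrightarrow> s \<in> S \<Longrightarrow> g \<otimes> s \<otimes> inv g \<in> S"
    and uv: "u \<in> carrier G" "v \<in> carrier G"
  shows "gdist (with_proj (Cay G S)) (exchange u v x) (exchange u v y)
    \<le> gdist (with_proj (Cay G S)) x y"
proof (rule wf_digraph.gdist_endomorphism_le[OF wf_digraph_Cay,
      where g = "map_prod (exchange u v) (exchange u v)"])
  fix a assume a: "a \<in> arcs (with_proj (Cay G S))"
  obtain x y where xy: "a = (x, y)" "x \<in> carrier G" "y \<in> carrier G" "y \<otimes> inv x \<in> S"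
    using a by (auto simp: Cay_def)
  then have "exchange u v y \<otimes> inv (exchange u v x) \<in> S"
    unfolding exchange_quotient[OF uv xy(2,3)] by (intro conj inv_closed) (use uv in auto)
  with xy uv show
    "map_prod (exchange u v) (exchange u v) a \<in> arcs (with_proj (Cay G S))"
    by (simp add: Cay_def)
qed (use uv in \<open>auto simp: Cay_def\<close>)

lemma CDDR_Cay_if_conjugation_closed:
  assumes inv_closed: "\<And>s. s \<in> S \<Longrightarrow> inv s \<in> S"
    and conj: "\<And>g s. g \<in> carrier G \<Longrightarrow> s \<in> S \<Longrightarrow> g \<otimes> s \<otimes> inv g \<in> S"
  shows "CDDR (with_proj (Cay G S))"
proof (rule CDDR_if_isometries_exchange)
  let ?C = "with_proj (Cay G S)"
  have V: "verts ?C = carrier G" by (simp add: Cay_def)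
  fix u v assume "u \<in> verts ?C" "v \<in> verts ?C"
  then have uv: "u \<in> carrier G" "v \<in> carrier G" by (simp_all add: Cay_def)
  have le: "gdist ?C (exchange a b x) (exchange a b y) \<le> gdist ?C x y"
    if "a \<in> carrier G" "b \<in> carrier G" for a b x y
    using inv_closed conj that by (rule gdist_Cay_exchange_le)
  have "bij_betw (exchange u v) (carrier G) (carrier G)"
    by (rule bij_betw_byWitness[where f' = "exchange v u"]) (auto simp: uv exchange_exchange)
  moreover have "gdist ?C (exchange u v x) (exchange u v y) = gdist ?C x y"
    if "x \<in> carrier G" "y \<in> carrier G" for x y
  proof (rule antisym)
    show "gdist ?C (exchange u v x) (exchange u v y) \<le> gdist ?C x y"
      using uv by (rule le)
    show "gdist ?C x y \<le> gdist ?C (exchange u v x) (exchange u v y)"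
      using le[OF uv(2,1), of "exchange u v x" "exchange u v y"]
      by (simp add: exchange_exchange uv that)
  qed
  ultimately show "\<exists>f. bij_betw f (verts ?C) (verts ?C) \<and>
      (\<forall>x\<in>verts ?C. \<forall>y\<in>verts ?C. gdist ?C (f x) (f y) = gdist ?C x y) \<and> f u = v \<and> f v = u"
    unfolding V using uv by (intro exI[of _ "exchange u v"]) (simp add: exchange_left exchange_right)
qed

end

theorem theorem8p6:
  fixes H :: "('a, 'm) monoid_scheme" and S :: "'a set"
  assumes "group H"
    and "finite (carrier H)"
    and "S \<subseteq> carrier H"
    and "generate H S = carrier H"
    and "\<one>\<^bsub>H\<^esub> \<notin> S"
    and "set_inv\<^bsub>H\<^esub> S = S"
    and "\<And>h. h \<in> S \<Longrightarrow> (h <#\<^bsub>H\<^esub> S) #>\<^bsub>H\<^esub> inv\<^bsub>H\<^esub> h = S"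
  shows "CDDR (with_proj (Cay H S))"
proof -
  interpret group H by fact
  have inv_closed: "inv\<^bsub>H\<^esub> s \<in> S" if "s \<in> S" for s
    using that assms(6) by (auto simp: SET_INV_def)
  have conj: "h \<otimes>\<^bsub>H\<^esub> s \<otimes>\<^bsub>H\<^esub> inv\<^bsub>H\<^esub> h \<in> S" if "h \<in> S" "s \<in> S" for h s
    using assms(7)[OF that(1)] that(2) by (auto simp: l_coset_def r_coset_def)
  have "g \<otimes>\<^bsub>H\<^esub> s \<otimes>\<^bsub>H\<^esub> inv\<^bsub>H\<^esub> g \<in> S" if "g \<in> carrier H" "s \<in> S" for g s
    using assms(3,4) inv_closed conj that by (rule conjugation_closed_if_generating)
  with inv_closed show ?thesis by (rule CDDR_Cay_if_conjugation_closed)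
qed

end
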